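(* Let $k>0$ be an integer, let $f:\mathbb{R}\to\mathbb{R}$ be an analytic function that is not a polynomial of degree $k$ or smaller, and let $x_0\in\mathbb{R}$. Let $\ell\ge 1$ be the smallest positive integer such that $f^{(k+\ell)}(x_0)\ne 0$. Then $$\lim_{\epsilon\to 0^+}\frac{\operatorname{wid}\left(I^{\mathrm{Lagrange}}_k(f,[x_0,x_0+\epsilon])\right)}{\operatorname{wid}\left(I^*_k(f,x_0,[x_0,x_0+\epsilon])\right)}=\binom{k+\ell}{\ell}.$$ Furthermore, both $I^{\mathrm{Lagrange}}_k(f,[x_0,x_0+\epsilon])$ and $I^*_k(f,x_0,[x_0,x_0+\epsilon])$ have width $O(\epsilon^\ell)$ as $\epsilon\to 0^+$.
   Context: For an interval $I=[\underline{z},\overline{z}]$, $\operatorname{wid}(I)=\overline{z}-\underline{z}$. For $a\le b$, $$I^{\mathrm{Lagrange}}_k(f,[a,b])=\frac{1}{k!}\left[\inf_{y\in[a,b]}f^{(k)}(y),\ \sup_{y\in[a,b]}f^{(k)}(y)\right].$$ For an integer $j\ge 0$, $R_j(x;f,x_0)=f(x)-\sum_{i=0}^{j}\frac{1}{i!}f^{(i)}(x_0)(x-x_0)^i$ is the Taylor remainder of $f$ at $x_0$. The interval defining the degree $k$ sharp Taylor polynomial enclosure of $f$ at $x_0$ over $[a,b]$ is $$I^*_k(f,x_0,[a,b])=\left[\inf_{x\in[a,b]\setminus\{x_0\}}\frac{R_{k-1}(x;f,x_0)}{(x-x_0)^k},\ \sup_{x\in[a,b]\setminus\{x_0\}}\frac{R_{k-1}(x;f,x_0)}{(x-x_0)^k}\right].$$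 *)

theory Defs
  imports "HOL-Analysis.Analysis" "HOL-Library.Interval" "HOL-Library.Landau_Symbols"
begin

(* The library's analytic_on is restricted to complex functions. *)
definition real_analytic :: "(real \<Rightarrow> real) \<Rightarrow> bool" where
  "real_analytic f \<longleftrightarrow> (\<forall>x. \<exists>F. (\<lambda>h. f (x + h)) has_fps_expansion F)"

definition taylor_remainder :: "nat \<Rightarrow> (real \<Rightarrow> real) \<Rightarrow> real \<Rightarrow> real \<Rightarrow> real" where
  "taylor_remainder j f x0 x =
     f x - (\<Sum>i\<le>j. 1 / fact i * (deriv ^^ i) f x0 * (x - x0) ^ i)"

(* In the two interval definitions, Interval (l, u) is the interval with endpoints l and u
   only if l \<le> u; the infima and suprema are meaningful only over nonempty sets of reals on
   which the function concerned is bounded. For analytic f this is the case when a \<le> b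
   in the first definition, and when k > 0, a < b and x0 \<in> {a..b} in the second. *)
definition lagrange_enclosure :: "nat \<Rightarrow> (real \<Rightarrow> real) \<Rightarrow> real \<Rightarrow> real \<Rightarrow> real interval" where
  "lagrange_enclosure k f a b =
     interval_of (1 / fact k) *
     Interval (INF y\<in>{a..b}. (deriv ^^ k) f y, SUP y\<in>{a..b}. (deriv ^^ k) f y)"

definition sharp_enclosure ::
    "nat \<Rightarrow> (real \<Rightarrow> real) \<Rightarrow> real \<Rightarrow> real \<Rightarrow> real \<Rightarrow> real interval" where
  "sharp_enclosure k f x0 a b =
     Interval (INF x\<in>{a..b} - {x0}. taylor_remainder (k - 1) f x0 x / (x - x0) ^ k,
               SUP x\<in>{a..b} - {x0}. taylor_remainder (k - 1) f x0 x / (x - x0) ^ k)"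

end

theory Submission
  imports Defs
begin

text \<open>
  Write \<open>a\<close> for the expansion point and \<open>d\<close> for the derivative of order \<open>k + l\<close> at \<open>a\<close>,
  the first nonzero one beyond order \<open>k\<close>. Both enclosures run from the infimum to the supremum of a function that is
  constant up to a leading term of order \<open>l\<close> at \<open>a\<close>. For the Lagrange enclosure, Taylor's theorem
  applied to the \<open>k\<close>-th derivative gives
  \<open>f\<^sup>(\<^sup>k\<^sup>)(x) / k! = f\<^sup>(\<^sup>k\<^sup>)(a) / k! + d / (k! l!) (x - a)\<^sup>l + o((x - a)\<^sup>l)\<close>. For the sharp enclosure,
  Taylor's theorem applied to \<open>f\<close> and divided by \<open>(x - a)\<^sup>k\<close> gives the quotient
  \<open>f\<^sup>(\<^sup>k\<^sup>)(a) / k! + d / (k + l)! (x - a)\<^sup>l + o((x - a)\<^sup>l)\<close>. Both expansions are instances of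
  \<open>remainder_quotient_tendsto\<close>.

  A function \<open>A + c (x - a)\<^sup>l + o((x - a)\<^sup>l)\<close> with \<open>c \<noteq> 0\<close> has, over an interval of length \<open>\<epsilon>\<close> to
  the right of \<open>a\<close>, a range of width \<open>\<bar>c\<bar> \<epsilon>\<^sup>l + o(\<epsilon>\<^sup>l)\<close> (\<open>oscillation_asymptotics\<close>). Hence the two
  widths are asymptotic to \<open>\<bar>d\<bar> \<epsilon>\<^sup>l / (k! l!)\<close> and \<open>\<bar>d\<bar> \<epsilon>\<^sup>l / (k + l)!\<close>, which yields both orders of
  magnitude, and the quotient of the two constants is the binomial coefficient.

  Analyticity enters in two ways: it makes \<open>f\<close> smooth, and it guarantees that \<open>l\<close> exists. If all
  derivatives beyond order \<open>k\<close> vanished at \<open>a\<close>, the derivative of order \<open>k + 1\<close> would vanish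
  identically by unique continuation (\<open>real_analytic_identity\<close>), making \<open>f\<close> a polynomial of degree
  at most \<open>k\<close>.
\<close>

section \<open>Smoothness and unique continuation of real analytic functions\<close>

lemma deriv_shift: "deriv (\<lambda>h. f (x + h)) = (\<lambda>h. deriv f (x + h))" for x :: "'a :: real_normed_field"
proof
  fix h
  show "deriv (\<lambda>h. f (x + h)) h = deriv f (x + h)"
    unfolding deriv_def using DERIV_shift[of f _ h x] by (simp add: add.commute)
qed

lemma higher_deriv_shift:
  "(deriv ^^ n) (\<lambda>h. f (x + h)) = (\<lambda>h. (deriv ^^ n) f (x + h))" for x :: "'a :: real_normed_field"
  by (induction n) (simp_all add: deriv_shift)

lemma higher_deriv_higher_deriv: "(deriv ^^ n) ((deriv ^^ m) f) = (deriv ^^ (m + n)) f"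
  by (metis add.commute comp_apply funpow_add)

lemma has_fps_expansion_higher_deriv:
  fixes f :: "real \<Rightarrow> real"
  assumes "f has_fps_expansion F"
  shows "(deriv ^^ n) f has_fps_expansion (fps_deriv ^^ n) F"
  by (induction n) (auto intro: assms has_fps_expansion_deriv)

lemma real_analytic_deriv:
  assumes "real_analytic f"
  shows "real_analytic (deriv f)"
  unfolding real_analytic_def
proof
  fix x
  obtain F where "(\<lambda>h. f (x + h)) has_fps_expansion F"
    using assms unfolding real_analytic_def by blast
  from has_fps_expansion_deriv[OF this]
  show "\<exists>F. (\<lambda>h. deriv f (x + h)) has_fps_expansion F"
    unfolding deriv_shift by blast
qed

lemma real_analytic_higher_deriv:
  "real_analytic f \<Longrightarrow> real_analytic ((deriv ^^ n) f)"
  by (induction n) (auto intro: real_analytic_deriv)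

text \<open>
  An analytic function agrees near each point with the sum of a power series, which may be
  differentiated term by term.
\<close>

lemma real_analytic_DERIV:
  assumes "real_analytic f"
  shows "(f has_real_derivative deriv f x) (at x)"
proof -
  obtain F where F: "(\<lambda>h. f (x + h)) has_fps_expansion F"
    using assms unfolding real_analytic_def by blast
  hence "(eval_fps F has_real_derivative eval_fps (fps_deriv F) 0) (at 0)"
    by (intro has_field_derivative_eval_fps) (auto simp: has_fps_expansion_def zero_ereal_def)
  moreover have "\<forall>\<^sub>F h in nhds 0. eval_fps F h = f (x + h)"
    using F by (simp add: has_fps_expansion_def)
  ultimately have "((\<lambda>h. f (x + h)) has_real_derivative eval_fps (fps_deriv F) 0) (at 0)"
    by (subst (asm) DERIV_cong_ev[OF refl _ refl])
  hence "(f has_real_derivative eval_fps (fps_deriv F) 0) (at x)"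
    using DERIV_shift[of f _ 0 x] by (simp add: add.commute)
  thus ?thesis by (metis DERIV_imp_deriv)
qed

lemma real_analytic_higher_DERIV:
  assumes "real_analytic f"
  shows "((deriv ^^ n) f has_real_derivative (deriv ^^ Suc n) f x) (at x)"
  using real_analytic_DERIV[OF real_analytic_higher_deriv[OF assms]] by simp

lemma real_analytic_isCont:
  "real_analytic f \<Longrightarrow> isCont f x"
  using real_analytic_DERIV DERIV_isCont by blast

text \<open>
  The coefficients of the local expansion are the derivatives divided by factorials, so a flat
  point has the zero series as its expansion.
\<close>

lemma real_analytic_flat_imp_locally_zero:
  assumes "real_analytic f" and flat: "\<And>n. (deriv ^^ n) f x = 0"
  shows "\<forall>\<^sub>F y in nhds x. f y = 0"
proof -
  obtain F where F: "(\<lambda>h. f (x + h)) has_fps_expansion F"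
    using assms unfolding real_analytic_def by blast
  have "fps_nth F n = 0" for n
  proof -
    have "(\<lambda>h. (deriv ^^ n) f (x + h)) has_fps_expansion (fps_deriv ^^ n) F"
      using has_fps_expansion_higher_deriv[OF F] by (simp add: higher_deriv_shift)
    from eventually_nhds_x_imp_x[OF conjunct2[OF this[unfolded has_fps_expansion_def]]]
    have "fps_nth ((fps_deriv ^^ n) F) 0 = 0" using flat by (simp add: eval_fps_at_0)
    thus ?thesis by (simp add: fps_0th_higher_deriv)
  qed
  hence "F = 0" by (simp add: fps_eq_iff)
  hence "\<forall>\<^sub>F h in nhds 0. f (x + h) = 0"
    using F by (auto simp: has_fps_expansion_def elim: eventually_mono)
  hence "\<forall>\<^sub>F y in nhds x. f (x + (y - x)) = 0"
    by (rule eventually_compose_filterlim) (auto intro!: tendsto_eq_intros filterlim_ident)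
  thus ?thesis by simp
qed

text \<open>
  The set of flat points is closed because all derivatives are continuous, and open because the
  function vanishes in a neighbourhood of a flat point; the real line being connected, one flat
  point makes every point flat.
\<close>

theorem real_analytic_identity:
  assumes f: "real_analytic f" and flat: "\<And>n. (deriv ^^ n) f x = 0"
  shows "f y = 0"
proof -
  define S where "S = {x. \<forall>n. (deriv ^^ n) f x = 0}"
  have "closed S"
  proof -
    have "S = (\<Inter>n. (deriv ^^ n) f -` {0})" by (auto simp: S_def)
    moreover have "closed ((deriv ^^ n) f -` {0})" for n
      by (rule continuous_closed_vimage)
         (use real_analytic_isCont[OF real_analytic_higher_deriv[OF f]] in auto)
    ultimately show ?thesis by auto
  qed
  moreover have "open S"
  proof (subst open_subopen, intro ballI)
    fix x assume "x \<in> S"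
    hence "\<forall>\<^sub>F y in nhds x. f y = 0"
      by (intro real_analytic_flat_imp_locally_zero f) (auto simp: S_def)
    then obtain T where T: "open T" "x \<in> T" "\<And>y. y \<in> T \<Longrightarrow> f y = 0"
      by (auto simp: eventually_nhds)
    have "(deriv ^^ n) f y = 0" if "y \<in> T" for n y
      using that
    proof (induction n arbitrary: y)
      case (Suc n)
      have "\<forall>\<^sub>F z in nhds y. (deriv ^^ n) f z = 0"
        using T(1) Suc unfolding eventually_nhds by blast
      hence "deriv ((deriv ^^ n) f) y = deriv (\<lambda>_. 0) y"
        by (intro deriv_cong_ev) auto
      thus ?case by simp
    qed (use T in auto)
    hence "T \<subseteq> S" by (auto simp: S_def)
    thus "\<exists>T. open T \<and> x \<in> T \<and> T \<subseteq> S" using T by blast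
  qed
  moreover have "S \<noteq> {}" using flat by (auto simp: S_def)
  ultimately have "S = UNIV"
    using clopen by auto
  hence "(deriv ^^ 0) f y = 0" unfolding S_def by blast
  thus ?thesis by simp
qed

section \<open>Leading term of the Taylor remainder\<close>

text \<open>
  Taylor's theorem with Lagrange remainder, free of the distinction between the two sides of the
  expansion point. The position of the intermediate point is recorded only as a distance, which is
  all that a limit towards the expansion point needs.
\<close>

lemma Taylor_two_sided:
  fixes f :: "real \<Rightarrow> real"
  assumes smooth: "\<And>m t. ((deriv ^^ m) f has_real_derivative (deriv ^^ Suc m) f t) (at t)"
    and "n > 0" "x \<noteq> a"
  shows "\<exists>t. \<bar>t - a\<bar> \<le> \<bar>x - a\<bar> \<and>
    f x = (\<Sum>i<n. (deriv ^^ i) f a / fact i * (x - a) ^ i) + (deriv ^^ n) f t / fact n * (x - a) ^ n"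
proof -
  have "\<exists>t. (if x < a then x < t \<and> t < a else a < t \<and> t < x) \<and>
    f x = (\<Sum>i<n. (deriv ^^ i) f a / fact i * (x - a) ^ i) + (deriv ^^ n) f t / fact n * (x - a) ^ n"
    by (rule Taylor[where a = "min a x" and b = "max a x"]) (use assms in auto)
  then obtain t where t: "if x < a then x < t \<and> t < a else a < t \<and> t < x"
    "f x = (\<Sum>i<n. (deriv ^^ i) f a / fact i * (x - a) ^ i) + (deriv ^^ n) f t / fact n * (x - a) ^ n"
    by blast
  have "\<bar>t - a\<bar> \<le> \<bar>x - a\<bar>" using t(1) by (auto split: if_splits)
  thus ?thesis using t(2) by blast
qed

text \<open>
  By unique continuation the derivative of order \<open>k + 1\<close> vanishes identically, and with it the
  Lagrange remainder, so the function equals its Taylor polynomial of degree \<open>k\<close>.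
\<close>

lemma polynomial_if_high_derivs_vanish:
  assumes f: "real_analytic f" and flat: "\<And>m. m \<ge> 1 \<Longrightarrow> (deriv ^^ (k + m)) f a = 0"
  shows "\<exists>p :: real poly. degree p \<le> k \<and> (\<forall>x. f x = poly p x)"
proof -
  define p :: "real poly" where
    "p = (\<Sum>i<Suc k. smult ((deriv ^^ i) f a / fact i) ([:- a, 1:] ^ i))"
  have vanish: "(deriv ^^ Suc k) f y = 0" for y
  proof -
    have "(deriv ^^ n) ((deriv ^^ Suc k) f) a = 0" for n
      using flat[of "Suc n"] unfolding higher_deriv_higher_deriv by simp
    thus ?thesis by (rule real_analytic_identity[OF real_analytic_higher_deriv[OF f]])
  qed
  have poly_p: "poly p x = (\<Sum>i<Suc k. (deriv ^^ i) f a / fact i * (x - a) ^ i)" for x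
    unfolding p_def poly_sum by (intro sum.cong) auto
  have "f x = poly p x" for x
  proof (cases "x = a")
    case True
    have "(\<Sum>i<Suc k. (deriv ^^ i) f a / fact i * (a - a) ^ i) = f a"
      by (subst sum.lessThan_Suc_shift) simp
    thus ?thesis using True poly_p by simp
  next
    case False
    obtain t where "f x = (\<Sum>i<Suc k. (deriv ^^ i) f a / fact i * (x - a) ^ i) +
        (deriv ^^ Suc k) f t / fact (Suc k) * (x - a) ^ Suc k"
      using Taylor_two_sided[OF real_analytic_higher_DERIV[OF f] _ False, of "Suc k"] by blast
    thus ?thesis unfolding vanish poly_p by simp
  qed
  moreover have "degree p \<le> k"
    unfolding p_def
  proof (rule degree_sum_le)
    fix i assume "i \<in> {..<Suc k}"
    moreover have "degree (smult ((deriv ^^ i) f a / fact i) ([:- a, 1:] ^ i)) \<le> i"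
      using degree_smult_le degree_linear_power by metis
    ultimately show "degree (smult ((deriv ^^ i) f a / fact i) ([:- a, 1:] ^ i)) \<le> k" by simp
  qed simp
  ultimately show ?thesis by (intro exI[of _ p] conjI allI)
qed

text \<open>
  The intermediate point in the Lagrange remainder is squeezed towards the expansion point, where the
  \<open>n\<close>-th derivative is continuous.
\<close>

lemma Taylor_remainder_tendsto:
  fixes f :: "real \<Rightarrow> real"
  assumes smooth: "\<And>m t. ((deriv ^^ m) f has_real_derivative (deriv ^^ Suc m) f t) (at t)"
    and "n > 0"
  shows "((\<lambda>x. (f x - (\<Sum>i<n. (deriv ^^ i) f a / fact i * (x - a) ^ i)) / (x - a) ^ n)
           \<longlongrightarrow> (deriv ^^ n) f a / fact n) (at a)"
proof -
  obtain t where t: "\<And>x. x \<noteq> a \<Longrightarrow> \<bar>t x - a\<bar> \<le> \<bar>x - a\<bar> \<and>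
    f x = (\<Sum>i<n. (deriv ^^ i) f a / fact i * (x - a) ^ i) + (deriv ^^ n) f (t x) / fact n * (x - a) ^ n"
  proof -
    let ?P = "\<lambda>x t. \<bar>t - a\<bar> \<le> \<bar>x - a\<bar> \<and> f x = (\<Sum>i<n. (deriv ^^ i) f a / fact i * (x - a) ^ i) +
      (deriv ^^ n) f t / fact n * (x - a) ^ n"
    have "\<forall>x\<in>-{a}. \<exists>t. ?P x t" using Taylor_two_sided[OF assms] by simp
    from bchoice[OF this] show ?thesis using that by auto
  qed
  have "((\<lambda>x. t x - a) \<longlongrightarrow> 0) (at a)"
  proof (rule Lim_null_comparison)
    show "\<forall>\<^sub>F x in at a. norm (t x - a) \<le> \<bar>x - a\<bar>"
      using t by (auto simp: eventually_at_filter)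
    show "((\<lambda>x. \<bar>x - a\<bar>) \<longlongrightarrow> 0) (at a)"
      by (auto intro!: tendsto_eq_intros)
  qed
  hence "(t \<longlongrightarrow> a) (at a)" by (simp add: LIM_zero_iff)
  moreover have "isCont ((deriv ^^ n) f) a"
    using smooth DERIV_isCont by blast
  ultimately have "((\<lambda>x. (deriv ^^ n) f (t x) / fact n) \<longlongrightarrow> (deriv ^^ n) f a / fact n) (at a)"
    by (intro tendsto_divide isCont_tendsto_compose[of a "(deriv ^^ n) f"] tendsto_const) auto
  moreover have "(deriv ^^ n) f (t x) / fact n
      = (f x - (\<Sum>i<n. (deriv ^^ i) f a / fact i * (x - a) ^ i)) / (x - a) ^ n" if "x \<noteq> a" for x
  proof -
    have "f x - (\<Sum>i<n. (deriv ^^ i) f a / fact i * (x - a) ^ i) = (deriv ^^ n) f (t x) / fact n * (x - a) ^ n"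
      using t[OF that] by linarith
    thus ?thesis using that by simp
  qed
  hence "\<forall>\<^sub>F x in at a. (deriv ^^ n) f (t x) / fact n
      = (f x - (\<Sum>i<n. (deriv ^^ i) f a / fact i * (x - a) ^ i)) / (x - a) ^ n"
    by (simp add: eventually_at_filter)
  ultimately show ?thesis by (rule Lim_transform_eventually)
qed

text \<open>
  If the derivatives of orders strictly between \<open>p\<close> and \<open>p + l\<close> vanish, the Taylor polynomial with
  terms of order below \<open>p + l\<close> consists of the terms below order \<open>p\<close> and the term of order \<open>p\<close>.
  Dividing the remainder by \<open>(x - a)\<^sup>p\<close> turns the latter into a constant. The case \<open>p = k\<close> describes
  the function behind the sharp enclosure; the case \<open>p = 0\<close> concerns the function itself and is
  applied to the \<open>k\<close>-th derivative.
\<close>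

lemma remainder_quotient_tendsto:
  fixes f :: "real \<Rightarrow> real"
  assumes smooth: "\<And>m t. ((deriv ^^ m) f has_real_derivative (deriv ^^ Suc m) f t) (at t)"
    and "l > 0" and gap: "\<And>m. \<lbrakk>0 < m; m < l\<rbrakk> \<Longrightarrow> (deriv ^^ (p + m)) f a = 0"
  shows "((\<lambda>x. ((f x - (\<Sum>i<p. (deriv ^^ i) f a / fact i * (x - a) ^ i)) / (x - a) ^ p
                 - (deriv ^^ p) f a / fact p) / (x - a) ^ l)
           \<longlongrightarrow> (deriv ^^ (p + l)) f a / fact (p + l)) (at a)"
proof -
  have sum_eq: "(\<Sum>i<p + l. (deriv ^^ i) f a / fact i * (x - a) ^ i) =
      (\<Sum>i<p. (deriv ^^ i) f a / fact i * (x - a) ^ i) + (deriv ^^ p) f a / fact p * (x - a) ^ p" for x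
  proof -
    have "(\<Sum>i<p + l. (deriv ^^ i) f a / fact i * (x - a) ^ i) =
      (\<Sum>i<Suc p. (deriv ^^ i) f a / fact i * (x - a) ^ i)"
    proof (rule sum.mono_neutral_right)
      show "\<forall>i\<in>{..<p + l} - {..<Suc p}. (deriv ^^ i) f a / fact i * (x - a) ^ i = 0"
      proof
        fix i assume "i \<in> {..<p + l} - {..<Suc p}"
        thus "(deriv ^^ i) f a / fact i * (x - a) ^ i = 0"
          using gap[of "i - p"] by auto
      qed
    qed (use \<open>l > 0\<close> in auto)
    thus ?thesis by simp
  qed
  have "\<forall>\<^sub>F x in at a. (f x - (\<Sum>i<p + l. (deriv ^^ i) f a / fact i * (x - a) ^ i)) / (x - a) ^ (p + l)
     = ((f x - (\<Sum>i<p. (deriv ^^ i) f a / fact i * (x - a) ^ i)) / (x - a) ^ p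
                 - (deriv ^^ p) f a / fact p) / (x - a) ^ l"
    unfolding eventually_at_filter sum_eq
    by (intro always_eventually allI impI) (simp add: power_add diff_divide_distrib add_divide_distrib)
  moreover have "p + l > 0" using \<open>l > 0\<close> by simp
  note Taylor_remainder_tendsto[OF smooth this, of a]
  ultimately show ?thesis by (rule Lim_transform_eventually[rotated])
qed

section \<open>Oscillation of a function near an endpoint\<close>

text \<open>
  For \<open>0 < e < c\<close> and \<open>x\<close> close to \<open>a\<close>, the value at \<open>x\<close> lies between \<open>A + (c - e) (x - a)\<^sup>l\<close> and
  \<open>A + (c + e) (x - a)\<^sup>l\<close>. So the infimum is \<open>A\<close>, approached at the left end, while the supremum is
  at least the value at the right end and at most the largest upper bound. The family \<open>S\<close>
  leaves open whether the left end belongs to the domain, since it does for the Lagrange enclosure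
  but not for the sharp one.
\<close>

lemma oscillation_asymptotics_pos:
  fixes \<phi> :: "real \<Rightarrow> real"
  assumes lim: "((\<lambda>x. (\<phi> x - A) / (x - a) ^ l) \<longlongrightarrow> c) (at_right a)"
    and "c > 0" "l > 0"
    and S: "\<And>\<epsilon>. \<epsilon> > 0 \<Longrightarrow> {a<..a + \<epsilon>} \<subseteq> S \<epsilon>" "\<And>\<epsilon>. \<epsilon> > 0 \<Longrightarrow> S \<epsilon> \<subseteq> {a..a + \<epsilon>}"
    and base: "\<And>\<epsilon>. \<epsilon> > 0 \<Longrightarrow> a \<in> S \<epsilon> \<Longrightarrow> \<phi> a = A"
  shows "(\<forall>\<^sub>F \<epsilon> in at_right 0. (INF x\<in>S \<epsilon>. \<phi> x) \<le> (SUP x\<in>S \<epsilon>. \<phi> x)) \<and>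
    ((\<lambda>\<epsilon>. ((SUP x\<in>S \<epsilon>. \<phi> x) - (INF x\<in>S \<epsilon>. \<phi> x)) / \<epsilon> ^ l) \<longlongrightarrow> c) (at_right 0)"
proof -
  have to_A: "(\<phi> \<longlongrightarrow> A) (at_right a)"
  proof -
    have "((\<lambda>x. A + (\<phi> x - A) / (x - a) ^ l * (x - a) ^ l) \<longlongrightarrow> A + c * (a - a) ^ l) (at_right a)"
      by (intro tendsto_intros lim)
    hence "((\<lambda>x. A + (\<phi> x - A) / (x - a) ^ l * (x - a) ^ l) \<longlongrightarrow> A) (at_right a)"
      using \<open>l > 0\<close> by (simp only: diff_self zero_power mult_zero_right add_0_right)
    moreover have "\<forall>\<^sub>F x in at_right a. A + (\<phi> x - A) / (x - a) ^ l * (x - a) ^ l = \<phi> x"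
      by (auto simp: eventually_at_filter)
    ultimately show ?thesis by (rule Lim_transform_eventually)
  qed
  have key: "\<forall>\<^sub>F \<epsilon> in at_right 0. (INF x\<in>S \<epsilon>. \<phi> x) \<le> (SUP x\<in>S \<epsilon>. \<phi> x) \<and>
      \<bar>((SUP x\<in>S \<epsilon>. \<phi> x) - (INF x\<in>S \<epsilon>. \<phi> x)) / \<epsilon> ^ l - c\<bar> \<le> e" if e: "0 < e" "e < c" for e
  proof -
    from tendstoD[OF lim e(1)]
    obtain b where b: "b > a" "\<And>x. a < x \<Longrightarrow> x < b \<Longrightarrow> \<bar>(\<phi> x - A) / (x - a) ^ l - c\<bar> < e"
      unfolding eventually_at_right_field dist_real_def by auto
    show ?thesis
      unfolding eventually_at_right_field
    proof (intro exI[of _ "b - a"] conjI allI impI)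
      show "0 < b - a" using b by simp
      fix \<epsilon> assume \<epsilon>: "0 < \<epsilon>" "\<epsilon> < b - a"
      have bounds: "A + (c - e) * (x - a) ^ l \<le> \<phi> x" "\<phi> x \<le> A + (c + e) * (x - a) ^ l"
        if "a < x" "x \<le> a + \<epsilon>" for x
      proof -
        have pos: "(x - a) ^ l > 0" using that by simp
        have "\<bar>(\<phi> x - A) / (x - a) ^ l - c\<bar> < e" using b that \<epsilon> by auto
        hence "c - e \<le> (\<phi> x - A) / (x - a) ^ l" "(\<phi> x - A) / (x - a) ^ l \<le> c + e" by linarith+
        thus "A + (c - e) * (x - a) ^ l \<le> \<phi> x" "\<phi> x \<le> A + (c + e) * (x - a) ^ l"
          unfolding pos_le_divide_eq[OF pos] pos_divide_le_eq[OF pos] by linarith+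
      qed
      have lower: "A \<le> \<phi> x" and upper: "\<phi> x \<le> A + (c + e) * \<epsilon> ^ l" if "x \<in> S \<epsilon>" for x
      proof -
        have nn: "(c + e) * \<epsilon> ^ l \<ge> 0" using e \<epsilon> by simp
        show "A \<le> \<phi> x"
        proof (cases "x = a")
          case False
          hence x: "a < x" "x \<le> a + \<epsilon>" using that S(2)[OF \<epsilon>(1)] by force+
          moreover have "(c - e) * (x - a) ^ l \<ge> 0" using e x by simp
          ultimately show ?thesis using bounds(1)[of x] by linarith
        qed (use base[OF \<epsilon>(1)] that in simp)
        show "\<phi> x \<le> A + (c + e) * \<epsilon> ^ l"
        proof (cases "x = a")
          case False
          hence x: "a < x" "x \<le> a + \<epsilon>" using that S(2)[OF \<epsilon>(1)] by force+
          moreover have "(c + e) * (x - a) ^ l \<le> (c + e) * \<epsilon> ^ l"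
            using e x by (intro mult_left_mono power_mono) auto
          ultimately show ?thesis using bounds(2)[of x] by linarith
        qed (use base[OF \<epsilon>(1)] that nn in simp)
      qed
      have bdd: "bdd_below (\<phi> ` S \<epsilon>)" "bdd_above (\<phi> ` S \<epsilon>)"
        using lower upper by (auto intro!: bdd_belowI2 bdd_aboveI2)
      have endpt: "a + \<epsilon> \<in> S \<epsilon>" using S(1)[OF \<epsilon>(1)] \<epsilon> by auto
      have inf: "(INF x\<in>S \<epsilon>. \<phi> x) = A"
      proof (rule antisym)
        show "A \<le> (INF x\<in>S \<epsilon>. \<phi> x)" using endpt lower by (intro cINF_greatest) auto
        have "\<forall>\<^sub>F x in at_right a. (INF x\<in>S \<epsilon>. \<phi> x) \<le> \<phi> x"
          unfolding eventually_at_right_field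
          using \<epsilon> S(1)[OF \<epsilon>(1)] bdd(1) by (intro exI[of _ "a + \<epsilon>"]) (auto intro!: cINF_lower)
        thus "(INF x\<in>S \<epsilon>. \<phi> x) \<le> A"
          using to_A by (intro tendsto_lowerbound[of \<phi>]) auto
      qed
      have sup: "A + (c - e) * \<epsilon> ^ l \<le> (SUP x\<in>S \<epsilon>. \<phi> x)" "(SUP x\<in>S \<epsilon>. \<phi> x) \<le> A + (c + e) * \<epsilon> ^ l"
      proof -
        show "(SUP x\<in>S \<epsilon>. \<phi> x) \<le> A + (c + e) * \<epsilon> ^ l"
          using endpt upper by (intro cSUP_least) auto
        have "A + (c - e) * \<epsilon> ^ l \<le> \<phi> (a + \<epsilon>)" using bounds(1)[of "a + \<epsilon>"] \<epsilon> by simp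
        also have "\<dots> \<le> (SUP x\<in>S \<epsilon>. \<phi> x)" using endpt bdd(2) by (intro cSUP_upper)
        finally show "A + (c - e) * \<epsilon> ^ l \<le> (SUP x\<in>S \<epsilon>. \<phi> x)" .
      qed
      have pos: "\<epsilon> ^ l > 0" using \<epsilon> by simp
      have "(c - e) * \<epsilon> ^ l \<ge> 0" using e \<epsilon> by simp
      thus "(INF x\<in>S \<epsilon>. \<phi> x) \<le> (SUP x\<in>S \<epsilon>. \<phi> x)" using sup inf by linarith
      have "c - e \<le> ((SUP x\<in>S \<epsilon>. \<phi> x) - A) / \<epsilon> ^ l" "((SUP x\<in>S \<epsilon>. \<phi> x) - A) / \<epsilon> ^ l \<le> c + e"
        unfolding pos_le_divide_eq[OF pos] pos_divide_le_eq[OF pos] using sup by linarith+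
      thus "\<bar>((SUP x\<in>S \<epsilon>. \<phi> x) - (INF x\<in>S \<epsilon>. \<phi> x)) / \<epsilon> ^ l - c\<bar> \<le> e"
        unfolding inf by linarith
    qed
  qed
  show ?thesis
  proof (intro conjI tendstoI)
    show "\<forall>\<^sub>F \<epsilon> in at_right 0. (INF x\<in>S \<epsilon>. \<phi> x) \<le> (SUP x\<in>S \<epsilon>. \<phi> x)"
      using key[of "c / 2"] \<open>c > 0\<close> by (auto elim: eventually_mono)
    fix e :: real assume "e > 0"
    \<comment> \<open>Halving both numbers turns the weak estimate into a strict one and meets \<open>e' < c\<close>.\<close>
    define e' where "e' = min (e / 2) (c / 2)"
    have e': "0 < e'" "e' < c" "e' < e" using \<open>e > 0\<close> \<open>c > 0\<close> by (auto simp: e'_def)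
    show "\<forall>\<^sub>F \<epsilon> in at_right 0.
        dist (((SUP x\<in>S \<epsilon>. \<phi> x) - (INF x\<in>S \<epsilon>. \<phi> x)) / \<epsilon> ^ l) c < e"
      using key[OF e'(1,2)] e'(3) by (auto simp: dist_real_def elim!: eventually_mono)
  qed
qed

text \<open>
  A negative leading coefficient reduces to a positive one by negating the function, which exchanges
  infimum and supremum and preserves their difference.
\<close>

lemma oscillation_asymptotics:
  fixes \<phi> :: "real \<Rightarrow> real"
  assumes lim: "((\<lambda>x. (\<phi> x - A) / (x - a) ^ l) \<longlongrightarrow> c) (at_right a)"
    and "c \<noteq> 0" "l > 0"
    and S: "\<And>\<epsilon>. \<epsilon> > 0 \<Longrightarrow> {a<..a + \<epsilon>} \<subseteq> S \<epsilon>" "\<And>\<epsilon>. \<epsilon> > 0 \<Longrightarrow> S \<epsilon> \<subseteq> {a..a + \<epsilon>}"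
    and base: "\<And>\<epsilon>. \<epsilon> > 0 \<Longrightarrow> a \<in> S \<epsilon> \<Longrightarrow> \<phi> a = A"
  shows "\<forall>\<^sub>F \<epsilon> in at_right 0. (INF x\<in>S \<epsilon>. \<phi> x) \<le> (SUP x\<in>S \<epsilon>. \<phi> x)" (is ?le)
    and "((\<lambda>\<epsilon>. ((SUP x\<in>S \<epsilon>. \<phi> x) - (INF x\<in>S \<epsilon>. \<phi> x)) / \<epsilon> ^ l) \<longlongrightarrow> \<bar>c\<bar>) (at_right 0)" (is ?lim)
proof -
  have "?le \<and> ?lim"
  proof (cases "c > 0")
    case True
    hence abs_c: "\<bar>c\<bar> = c" by simp
    show ?thesis
      unfolding abs_c by (rule oscillation_asymptotics_pos[OF lim True \<open>l > 0\<close>]) (fact S base)+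
  next
    case False
    have "((\<lambda>x. - ((\<phi> x - A) / (x - a) ^ l)) \<longlongrightarrow> - c) (at_right a)"
      by (intro tendsto_minus lim)
    hence "((\<lambda>x. (- \<phi> x - - A) / (x - a) ^ l) \<longlongrightarrow> - c) (at_right a)"
      by (simp add: minus_divide_left)
    hence "(\<forall>\<^sub>F \<epsilon> in at_right 0. (INF x\<in>S \<epsilon>. - \<phi> x) \<le> (SUP x\<in>S \<epsilon>. - \<phi> x)) \<and>
      ((\<lambda>\<epsilon>. ((SUP x\<in>S \<epsilon>. - \<phi> x) - (INF x\<in>S \<epsilon>. - \<phi> x)) / \<epsilon> ^ l) \<longlongrightarrow> - c) (at_right 0)"
      by (rule oscillation_asymptotics_pos) (use False \<open>c \<noteq> 0\<close> \<open>l > 0\<close> S base in auto)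
    moreover have "(INF x\<in>X. - \<phi> x) = - (SUP x\<in>X. \<phi> x)" "(SUP x\<in>X. - \<phi> x) = - (INF x\<in>X. \<phi> x)" for X
      by (simp_all add: Inf_real_def image_image)
    ultimately show ?thesis using False \<open>c \<noteq> 0\<close> by (simp add: abs_if)
  qed
  thus ?le ?lim by auto
qed

section \<open>Comparison of the two enclosures\<close>

lemma width_Interval: "u \<le> v \<Longrightarrow> width (Interval (u, v)) = v - u" for u v :: real
  by (simp add: width_def lower.rep_eq upper.rep_eq Interval_inverse)

lemma width_scaled_Interval:
  fixes c u v :: real
  assumes "c \<ge> 0" "u \<le> v"
  shows "width (interval_of c * Interval (u, v)) = c * (v - u)"
proof -
  have "lower (Interval (u, v)) = u" "upper (Interval (u, v)) = v"
    using assms by (simp_all add: lower.rep_eq upper.rep_eq Interval_inverse)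
  moreover have "c * u \<le> c * v" using assms by (intro mult_left_mono)
  ultimately show ?thesis
    by (simp add: width_def lower_times upper_times algebra_simps)
qed

theorem theorem3:
  fixes k l :: nat and f :: "real \<Rightarrow> real" and x0 :: real
  assumes "k > 0"
    and "real_analytic f"
    and "\<not> (\<exists>p :: real poly. degree p \<le> k \<and> (\<forall>x. f x = poly p x))"
    and "l = (LEAST m. m \<ge> 1 \<and> (deriv ^^ (k + m)) f x0 \<noteq> 0)"
  shows "((\<lambda>\<epsilon>. width (lagrange_enclosure k f x0 (x0 + \<epsilon>)) /
                width (sharp_enclosure k f x0 x0 (x0 + \<epsilon>)))
            \<longlongrightarrow> real ((k + l) choose l)) (at_right 0)
       \<and> (\<lambda>\<epsilon>. width (lagrange_enclosure k f x0 (x0 + \<epsilon>))) \<in> O[at_right 0](\<lambda>\<epsilon>. \<epsilon> ^ l)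
       \<and> (\<lambda>\<epsilon>. width (sharp_enclosure k f x0 x0 (x0 + \<epsilon>))) \<in> O[at_right 0](\<lambda>\<epsilon>. \<epsilon> ^ l)"
proof -
  define d where "d = (deriv ^^ (k + l)) f x0"
  define W where "W = (\<lambda>\<epsilon>. width (lagrange_enclosure k f x0 (x0 + \<epsilon>)))"
  define V where "V = (\<lambda>\<epsilon>. width (sharp_enclosure k f x0 x0 (x0 + \<epsilon>)))"
  have "\<exists>m. m \<ge> 1 \<and> (deriv ^^ (k + m)) f x0 \<noteq> 0"
    using polynomial_if_high_derivs_vanish[OF assms(2)] assms(3) by blast
  from LeastI_ex[OF this] have "l > 0" and "d \<noteq> 0"
    unfolding d_def assms(4)[symmetric] by auto
  have gap: "(deriv ^^ (k + m)) f x0 = 0" if "0 < m" "m < l" for m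
    using not_less_Least[OF that(2)[unfolded assms(4)]] that(1) by auto
  note smooth = real_analytic_higher_DERIV[OF assms(2)]

  define g where "g = (deriv ^^ k) f"
  have deriv_g: "(deriv ^^ m) g = (deriv ^^ (k + m)) f" for m
    unfolding g_def by (rule higher_deriv_higher_deriv)
  have smooth_g: "((deriv ^^ m) g has_real_derivative (deriv ^^ Suc m) g t) (at t)" for m t
    using smooth[of "k + m"] unfolding deriv_g by simp
  have "((\<lambda>x. (g x - g x0) / (x - x0) ^ l) \<longlongrightarrow> d / fact l) (at_right x0)"
    using remainder_quotient_tendsto[OF smooth_g \<open>l > 0\<close>, of 0 x0] gap
    by (auto simp: deriv_g d_def intro: filterlim_at_withinI tendsto_within_subset)
  note lim_g = this
  have g_osc: "\<forall>\<^sub>F \<epsilon> in at_right 0. (INF x\<in>{x0..x0 + \<epsilon>}. g x) \<le> (SUP x\<in>{x0..x0 + \<epsilon>}. g x)"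
      "((\<lambda>\<epsilon>. ((SUP x\<in>{x0..x0 + \<epsilon>}. g x) - (INF x\<in>{x0..x0 + \<epsilon>}. g x)) / \<epsilon> ^ l)
        \<longlongrightarrow> \<bar>d / fact l\<bar>) (at_right 0)"
    by (rule oscillation_asymptotics[OF lim_g]; use \<open>d \<noteq> 0\<close> \<open>l > 0\<close> in force)+
  have "\<forall>\<^sub>F \<epsilon> in at_right 0. W \<epsilon> =
      1 / fact k * ((SUP x\<in>{x0..x0 + \<epsilon>}. g x) - (INF x\<in>{x0..x0 + \<epsilon>}. g x))"
    using g_osc(1) unfolding W_def lagrange_enclosure_def g_def[symmetric]
    by eventually_elim (simp add: width_scaled_Interval)
  hence "\<forall>\<^sub>F \<epsilon> in at_right 0.
      1 / fact k * (((SUP x\<in>{x0..x0 + \<epsilon>}. g x) - (INF x\<in>{x0..x0 + \<epsilon>}. g x)) / \<epsilon> ^ l) = W \<epsilon> / \<epsilon> ^ l"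
    by eventually_elim simp
  from Lim_transform_eventually[OF tendsto_mult_left[OF g_osc(2)] this]
  have W: "((\<lambda>\<epsilon>. W \<epsilon> / \<epsilon> ^ l) \<longlongrightarrow> \<bar>d\<bar> / (fact k * fact l)) (at_right 0)"
    by (simp add: mult.commute)

  define q where "q = (\<lambda>x. taylor_remainder (k - 1) f x0 x / (x - x0) ^ k)"
  \<comment> \<open>As \<open>k > 0\<close>, the truncated subtraction \<open>k - 1\<close> is exact and the sum up to \<open>k - 1\<close> is the sum below \<open>k\<close>.\<close>
  have "q x = (f x - (\<Sum>i<k. (deriv ^^ i) f x0 / fact i * (x - x0) ^ i)) / (x - x0) ^ k" for x
    using \<open>k > 0\<close> lessThan_Suc_atMost[of "k - 1"] by (simp add: q_def taylor_remainder_def)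
  hence "((\<lambda>x. (q x - (deriv ^^ k) f x0 / fact k) / (x - x0) ^ l) \<longlongrightarrow> d / fact (k + l)) (at_right x0)"
    using remainder_quotient_tendsto[OF smooth \<open>l > 0\<close>, of k x0] gap
    by (auto simp: d_def intro: tendsto_within_subset)
  note lim_q = this
  have q_osc: "\<forall>\<^sub>F \<epsilon> in at_right 0. (INF x\<in>{x0..x0 + \<epsilon>} - {x0}. q x) \<le> (SUP x\<in>{x0..x0 + \<epsilon>} - {x0}. q x)"
      "((\<lambda>\<epsilon>. ((SUP x\<in>{x0..x0 + \<epsilon>} - {x0}. q x) - (INF x\<in>{x0..x0 + \<epsilon>} - {x0}. q x)) / \<epsilon> ^ l)
        \<longlongrightarrow> \<bar>d / fact (k + l)\<bar>) (at_right 0)"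
    by (rule oscillation_asymptotics[OF lim_q]; use \<open>d \<noteq> 0\<close> \<open>l > 0\<close> in force)+
  have "\<forall>\<^sub>F \<epsilon> in at_right 0. V \<epsilon> =
      (SUP x\<in>{x0..x0 + \<epsilon>} - {x0}. q x) - (INF x\<in>{x0..x0 + \<epsilon>} - {x0}. q x)"
    using q_osc(1) unfolding V_def sharp_enclosure_def q_def[symmetric]
    by eventually_elim (rule width_Interval)
  hence "\<forall>\<^sub>F \<epsilon> in at_right 0.
      ((SUP x\<in>{x0..x0 + \<epsilon>} - {x0}. q x) - (INF x\<in>{x0..x0 + \<epsilon>} - {x0}. q x)) / \<epsilon> ^ l = V \<epsilon> / \<epsilon> ^ l"
    by eventually_elim simp
  from Lim_transform_eventually[OF q_osc(2) this]
  have V: "((\<lambda>\<epsilon>. V \<epsilon> / \<epsilon> ^ l) \<longlongrightarrow> \<bar>d\<bar> / fact (k + l)) (at_right 0)"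
    by simp

  have nz: "\<forall>\<^sub>F \<epsilon> in at_right 0. \<epsilon> ^ l \<noteq> (0 :: real)"
    by (intro eventually_mono[OF eventually_at_right_less[of 0]]) simp
  have "((\<lambda>\<epsilon>. (W \<epsilon> / \<epsilon> ^ l) / (V \<epsilon> / \<epsilon> ^ l)) \<longlongrightarrow>
      (\<bar>d\<bar> / (fact k * fact l)) / (\<bar>d\<bar> / fact (k + l))) (at_right 0)"
    using \<open>d \<noteq> 0\<close> by (intro tendsto_divide W V) auto
  also have "(\<bar>d\<bar> / (fact k * fact l)) / (\<bar>d\<bar> / fact (k + l)) = real ((k + l) choose l)"
    using \<open>d \<noteq> 0\<close> by (simp add: binomial_fact mult.commute)
  finally have "((\<lambda>\<epsilon>. (W \<epsilon> / \<epsilon> ^ l) / (V \<epsilon> / \<epsilon> ^ l)) \<longlongrightarrow> real ((k + l) choose l)) (at_right 0)" .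
  moreover have "\<forall>\<^sub>F \<epsilon> in at_right 0. (W \<epsilon> / \<epsilon> ^ l) / (V \<epsilon> / \<epsilon> ^ l) = W \<epsilon> / V \<epsilon>"
    using nz by eventually_elim simp
  ultimately have "((\<lambda>\<epsilon>. W \<epsilon> / V \<epsilon>) \<longlongrightarrow> real ((k + l) choose l)) (at_right 0)"
    by (rule Lim_transform_eventually)
  moreover have "W \<in> O[at_right 0](\<lambda>\<epsilon>. \<epsilon> ^ l)" by (rule bigoI_tendsto[OF W nz])
  moreover have "V \<in> O[at_right 0](\<lambda>\<epsilon>. \<epsilon> ^ l)" by (rule bigoI_tendsto[OF V nz])
  ultimately show ?thesis unfolding W_def V_def by blast
qed

end
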